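(* Let $d\ge 1$. The set $\mathrm{BD}^{d}$ is not closed, and $\operatorname{cl}\mathrm{ED}^{d}\nsubseteq\mathrm{BD}^{d}$. If $d>1$, then $\mathrm{BD}^{d}$ is not open. (Topological notions refer to $\mathcal{L}^{\mathrm{Lya}}(\mathbb{N},\mathbb{R}^{d\times d})$ with the topology of uniform convergence, induced by $\|\cdot\|_\infty$.)
   Context: $\mathbb{N}=\{0,1,2,\dots\}$. $\|\cdot\|$ is the Euclidean norm on $\mathbb{R}^d$ and the induced operator norm on $\mathbb{R}^{d\times d}$. For a bounded sequence $B=(B(n))_{n\in\mathbb{N}}$ in $\mathbb{R}^{d\times d}$, $\|B\|_\infty=\sup_n\|B(n)\|$. $\mathcal{L}^{\mathrm{Lya}}(\mathbb{N},\mathbb{R}^{d\times d})$ is the set of sequences $B$ of invertible matrices such that both $B$ and $B^{-1}:=(B(n)^{-1})_{n}$ are bounded. For $A\in\mathcal{L}^{\mathrm{Lya}}(\mathbb{N},\mathbb{R}^{d\times d})$, $(x(n,x_0))_{n\in\mathbb{N}}$ denotes the solution of $x(n+1)=A(n)x(n)$ with $x(0)=x_0$. Exponential dichotomy: $A\in\mathrm{ED}^d$ iff $A\in\mathcal{L}^{\mathrm{Lya}}(\mathbb{N},\mathbb{R}^{d\times d})$ and there exist subspaces $L_1,L_2\subseteq\mathbb{R}^d$ with $\mathbb{R}^d=L_1\oplus L_2$, $\alpha>0$ and $K>0$ such that for all $n\ge m$: $\|x(n,x_0)\|\le Ke^{-\alpha(n-m)}\|x(m,x_0)\|$ for all $x_0\in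 L_1$, and $\|x(n,x_0)\|\ge K^{-1}e^{\alpha(n-m)}\|x(m,x_0)\|$ for all $x_0\in L_2$. Bohl dichotomy: $A\in\mathrm{BD}^d$ iff $A\in\mathcal{L}^{\mathrm{Lya}}(\mathbb{N},\mathbb{R}^{d\times d})$ and there exist subspaces $L_1,L_2\subseteq\mathbb{R}^d$ with $\mathbb{R}^d=L_1\oplus L_2$, $\alpha>0$ and functions $C_1,C_2:\mathbb{R}^d\to(0,\infty)$ such that for all $n\ge m$: $\|x(n,x_0)\|\le C_1(x_0)e^{-\alpha(n-m)}\|x(m,x_0)\|$ for all $x_0\in L_1$, and $\|x(n,x_0)\|\ge C_2(x_0)e^{\alpha(n-m)}\|x(m,x_0)\|$ for all $x_0\in L_2$. *)

theory Defs
  imports "HOL-Analysis.Analysis"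
begin

type_synonym 'd matseq = "nat \<Rightarrow> real^'d^'d"

text \<open>The type class norm on matrices is the Frobenius norm, so the operator norm
  induced by the Euclidean norm is expressed through \<^const>\<open>onorm\<close>.\<close>

definition op_norm :: "real^'d^'d \<Rightarrow> real" where
  "op_norm M = onorm (\<lambda>x. M *v x)"

definition bounded_seq :: "'d::finite matseq \<Rightarrow> bool" where
  "bounded_seq B \<longleftrightarrow> bdd_above (range (\<lambda>n. op_norm (B n)))"

definition norm_infty :: "'d::finite matseq \<Rightarrow> real" where
  "norm_infty B = (SUP n. op_norm (B n))"

definition Lya :: "('d::finite matseq) set" where
  "Lya = {B. (\<forall>n. invertible (B n)) \<and> bounded_seq B \<and> bounded_seq (\<lambda>n. matrix_inv (B n))}"

text \<open>Outside \<^const>\<open>Lya\<close> the supremum need not be meaningful; the value 0 there is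
  irrelevant for the topology and only serves the locale \<^locale>\<open>Metric_space\<close>, which
  requires nonnegativity and symmetry on the whole type.\<close>

definition Lya_dist :: "'d::finite matseq \<Rightarrow> 'd matseq \<Rightarrow> real" where
  "Lya_dist A B = (if A \<in> Lya \<and> B \<in> Lya then norm_infty (\<lambda>n. A n - B n) else 0)"

definition Lya_topology :: "('d::finite matseq) topology" where
  "Lya_topology = Metric_space.mtopology Lya Lya_dist"

primrec solution :: "'d::finite matseq \<Rightarrow> real^'d \<Rightarrow> nat \<Rightarrow> real^'d" where
  "solution A x0 0 = x0"
| "solution A x0 (Suc n) = A n *v solution A x0 n"

definition direct_decomposition :: "(real^'d::finite) set \<Rightarrow> (real^'d) set \<Rightarrow> bool" where
  "direct_decomposition L1 L2 \<longleftrightarrow> subspace L1 \<and> subspace L2 \<and>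
     L1 \<inter> L2 = {0} \<and> {u + v | u v. u \<in> L1 \<and> v \<in> L2} = UNIV"

definition ED :: "('d::finite matseq) set" where
  "ED = {A \<in> Lya. \<exists>L1 L2 \<alpha> K. direct_decomposition L1 L2 \<and> \<alpha> > 0 \<and> K > 0 \<and>
     (\<forall>x0\<in>L1. \<forall>m n. n \<ge> m \<longrightarrow>
        norm (solution A x0 n) \<le> K * exp (- \<alpha> * real (n - m)) * norm (solution A x0 m)) \<and>
     (\<forall>x0\<in>L2. \<forall>m n. n \<ge> m \<longrightarrow>
        norm (solution A x0 n) \<ge> inverse K * exp (\<alpha> * real (n - m)) * norm (solution A x0 m))}"

definition BD :: "('d::finite matseq) set" where
  "BD = {A \<in> Lya. \<exists>L1 L2 \<alpha> (C1 :: real^'d \<Rightarrow> real) (C2 :: real^'d \<Rightarrow> real).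
     direct_decomposition L1 L2 \<and> \<alpha> > 0 \<and> (\<forall>x. C1 x > 0) \<and> (\<forall>x. C2 x > 0) \<and>
     (\<forall>x0\<in>L1. \<forall>m n. n \<ge> m \<longrightarrow>
        norm (solution A x0 n) \<le> C1 x0 * exp (- \<alpha> * real (n - m)) * norm (solution A x0 m)) \<and>
     (\<forall>x0\<in>L2. \<forall>m n. n \<ge> m \<longrightarrow>
        norm (solution A x0 n) \<ge> C2 x0 * exp (\<alpha> * real (n - m)) * norm (solution A x0 m))}"

lemma op_norm_nonneg: "op_norm M \<ge> 0"
  unfolding op_norm_def by (rule onorm_pos_le) simp

lemma op_norm_eq_0: "op_norm M = 0 \<longleftrightarrow> M = 0"
  unfolding op_norm_def
  by (subst onorm_eq_0) (auto simp: matrix_eq)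

lemma op_norm_uminus: "op_norm (- M) = op_norm M"
proof -
  have "(\<lambda>x. (- M) *v x) = (\<lambda>x. - (M *v x))"
    by (metis diff_0 matrix_vector_mult_0 matrix_vector_mult_diff_rdistrib)
  then show ?thesis
    unfolding op_norm_def by (simp add: onorm_neg)
qed

lemma op_norm_triangle: "op_norm (M + N) \<le> op_norm M + op_norm N"
  unfolding op_norm_def matrix_vector_mult_add_rdistrib
  by (rule onorm_triangle) simp_all

lemma bounded_seq_diff:
  assumes "bounded_seq A" "bounded_seq B"
  shows "bounded_seq (\<lambda>n. A n - B n)"
proof -
  obtain a b where "\<And>n. op_norm (A n) \<le> a" "\<And>n. op_norm (B n) \<le> b"
    using assms unfolding bounded_seq_def bdd_above_def by auto
  moreover have "op_norm (A n - B n) \<le> op_norm (A n) + op_norm (B n)" for n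
    using op_norm_triangle[of "A n" "- B n"] by (simp add: op_norm_uminus)
  ultimately have "op_norm (A n - B n) \<le> a + b" for n
    by (meson add_mono order_trans)
  then show ?thesis
    unfolding bounded_seq_def bdd_above_def by blast
qed

lemma op_norm_le_norm_infty: "bounded_seq B \<Longrightarrow> op_norm (B n) \<le> norm_infty B"
  unfolding bounded_seq_def norm_infty_def by (rule cSUP_upper) auto

lemma Metric_space_Lya: "Metric_space (Lya :: ('d::finite matseq) set) Lya_dist"
proof
  fix A B C :: "'d matseq"
  have bd: "bounded_seq (\<lambda>n. X n - Y n)" if "X \<in> Lya" "Y \<in> Lya" for X Y :: "'d matseq"
    using that bounded_seq_diff unfolding Lya_def by blast
  have le: "op_norm (X n - Y n) \<le> Lya_dist X Y" if "X \<in> Lya" "Y \<in> Lya" for X Y :: "'d matseq" and n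
    using op_norm_le_norm_infty[OF bd[OF that]] that by (simp add: Lya_dist_def)
  show "0 \<le> Lya_dist A B"
    using le[of A B 0] op_norm_nonneg[of "A 0 - B 0"] by (auto simp: Lya_dist_def split: if_splits)
  have "op_norm (A n - B n) = op_norm (B n - A n)" for n
    using op_norm_uminus[of "A n - B n"] by simp
  then show "Lya_dist A B = Lya_dist B A"
    by (simp add: Lya_dist_def norm_infty_def)
  show "Lya_dist A B = 0 \<longleftrightarrow> A = B" if "A \<in> Lya" "B \<in> Lya"
  proof
    assume "Lya_dist A B = 0"
    then have "op_norm (A n - B n) = 0" for n
      using le[OF that, of n] op_norm_nonneg[of "A n - B n"] by simp
    then show "A = B" by (auto simp: op_norm_eq_0)
  next
    assume "A = B"
    then show "Lya_dist A B = 0"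
      by (simp add: Lya_dist_def norm_infty_def op_norm_eq_0[THEN iffD2])
  qed
  show "Lya_dist A C \<le> Lya_dist A B + Lya_dist B C" if "A \<in> Lya" "B \<in> Lya" "C \<in> Lya"
  proof -
    have "op_norm (A n - C n) \<le> Lya_dist A B + Lya_dist B C" for n
      using op_norm_triangle[of "A n - B n" "B n - C n"] le[OF that(1,2), of n] le[OF that(2,3), of n]
      by simp
    then show ?thesis
      using that by (simp add: Lya_dist_def norm_infty_def cSUP_least)
  qed
qed

lemma topspace_Lya_topology: "topspace Lya_topology = Lya"
  unfolding Lya_topology_def by (rule Metric_space.topspace_mtopology[OF Metric_space_Lya])

end

theory Submission
  imports Defs
begin

text \<open>The systems \<open>c I\<close> with \<open>c > 1\<close> have an exponential dichotomy and converge to the constant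
  system \<open>I\<close>, all of whose solutions have constant norm; this settles the first two claims.

  For the third, fix two coordinates \<open>i \<noteq> j\<close> and take the triangular system with solutions
  \<open>x_i(n) = p(n) c_i\<close>, \<open>x_j(n) = 4^-n (c_j - \<sigma>(n) c_i)\<close> and \<open>x_l(n) = 4^-n c_l\<close> otherwise.
  The amplitude \<open>p \<le> 4^-n\<close> has arbitrarily long plateaus, while \<open>\<sigma>\<close> decreases to 0 so slowly that
  \<open>p \<le> \<sigma> 4^-n\<close> on the plateaus, where the \<open>\<sigma>\<close> term therefore hides them: each solution is
  comparable either to \<open>4^-n\<close> or to \<open>max p (\<sigma> 4^-n)\<close>, and both at least halve in every step. So
  there is a Bohl dichotomy, although the constants depend on the solution. As \<open>\<sigma>\<close> changes only
  where \<open>p\<close> is close to \<open>4^-n\<close>, the coupling coefficient tends to 0, and switching it off from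
  time \<open>N\<close> on is a small perturbation. It freezes \<open>\<sigma>\<close> at \<open>\<sigma>(N)\<close>, so that the solution with
  \<open>c_j = \<sigma>(N) c_i\<close> equals \<open>p(n) c_i\<close> in coordinate \<open>i\<close> and 0 elsewhere for \<open>n \<ge> N\<close>. The plateaus
  exclude it from \<open>L1\<close>, and \<open>L2\<close> is trivial because every solution is bounded.\<close>

section \<open>Systems with a Lyapunov inverse\<close>

lemma op_norm_le_entries:
  fixes M :: "real^'d^'d"
  assumes "\<And>k l. \<bar>M $ k $ l\<bar> \<le> c"
  shows "op_norm M \<le> real CARD('d) * real CARD('d) * c"
  unfolding op_norm_def using assms by (rule onorm_le_matrix_component)

lemma LyaI:
  fixes A B :: "'d::finite matseq"
  assumes inv: "\<And>n. A n ** B n = mat 1" "\<And>n. B n ** A n = mat 1"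
    and bd: "\<And>n k l. \<bar>A n $ k $ l\<bar> \<le> c" "\<And>n k l. \<bar>B n $ k $ l\<bar> \<le> c"
  shows "A \<in> Lya"
proof -
  have "invertible (A n)" for n
    using inv unfolding invertible_def by blast
  moreover have "matrix_inv (A n) = B n" for n
  proof -
    \<comment> \<open>\<open>matrix_inv\<close> is a choice among two-sided inverses, so it is
      identified with \<open>B n\<close> by uniqueness: a left inverse multiplied by
      \<open>A n ** B n\<close> gives both.\<close>
    have "matrix_inv (A n) ** A n = mat 1"
      unfolding matrix_inv_def
      using someI[of "\<lambda>M. A n ** M = mat 1 \<and> M ** A n = mat 1" "B n"] inv by blast
    then show ?thesis
      by (metis inv(1) matrix_mul_assoc matrix_mul_lid matrix_mul_rid)
  qed
  moreover have "bounded_seq A" "bounded_seq B"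
    unfolding bounded_seq_def bdd_above_def
    using op_norm_le_entries[OF bd(1)] op_norm_le_entries[OF bd(2)] by blast+
  ultimately show ?thesis
    unfolding Lya_def by simp
qed

lemma Lya_dist_le_entries:
  fixes A B :: "'d::finite matseq"
  assumes "A \<in> Lya" "B \<in> Lya" "\<And>n k l. \<bar>A n $ k $ l - B n $ k $ l\<bar> \<le> c"
  shows "Lya_dist A B \<le> real CARD('d) * real CARD('d) * c"
proof -
  have "op_norm (A n - B n) \<le> real CARD('d) * real CARD('d) * c" for n
    by (rule op_norm_le_entries) (simp add: assms(3))
  then show ?thesis
    using assms(1,2) by (simp add: Lya_dist_def norm_infty_def cSUP_least)
qed

lemma ED_subset_BD: "ED \<subseteq> (BD :: ('d::finite matseq) set)"
proof
  fix A :: "'d matseq"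
  assume "A \<in> ED"
  then obtain L1 L2 \<alpha> K where "A \<in> Lya" "direct_decomposition L1 L2" "\<alpha> > 0" "K > 0"
    "\<forall>x0\<in>L1. \<forall>m n. n \<ge> m \<longrightarrow>
        norm (solution A x0 n) \<le> K * exp (- \<alpha> * real (n - m)) * norm (solution A x0 m)"
    "\<forall>x0\<in>L2. \<forall>m n. n \<ge> m \<longrightarrow>
        norm (solution A x0 n) \<ge> inverse K * exp (\<alpha> * real (n - m)) * norm (solution A x0 m)"
    unfolding ED_def by blast
  then show "A \<in> BD"
    unfolding BD_def
    by (intro CollectI conjI exI[of _ L1] exI[of _ L2] exI[of _ \<alpha>] exI[of _ "\<lambda>_. K"]
        exI[of _ "\<lambda>_. inverse K"]) simp_all
qed

lemma BD_E:
  fixes A :: "'d::finite matseq"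
  assumes "A \<in> BD"
  obtains L1 L2 \<alpha> C1 C2 where "direct_decomposition L1 L2" "\<alpha> > 0"
    "\<And>x. C1 x > 0" "\<And>x. C2 x > 0"
    "\<And>x m n. x \<in> L1 \<Longrightarrow> n \<ge> m \<Longrightarrow>
      norm (solution A x n) \<le> C1 x * exp (- \<alpha> * real (n - m)) * norm (solution A x m)"
    "\<And>x m n. x \<in> L2 \<Longrightarrow> n \<ge> m \<Longrightarrow>
      norm (solution A x n) \<ge> C2 x * exp (\<alpha> * real (n - m)) * norm (solution A x m)"
proof -
  from assms obtain L1 L2 \<alpha> and C1 C2 :: "real^'d \<Rightarrow> real" where
    "direct_decomposition L1 L2" "\<alpha> > 0" "\<forall>x. C1 x > 0" "\<forall>x. C2 x > 0"
    "\<forall>x0\<in>L1. \<forall>m n. n \<ge> m \<longrightarrow>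
        norm (solution A x0 n) \<le> C1 x0 * exp (- \<alpha> * real (n - m)) * norm (solution A x0 m)"
    "\<forall>x0\<in>L2. \<forall>m n. n \<ge> m \<longrightarrow>
        norm (solution A x0 n) \<ge> C2 x0 * exp (\<alpha> * real (n - m)) * norm (solution A x0 m)"
    unfolding BD_def by (elim CollectE conjE exE) (rule that)
  then show thesis
    by (intro that[of L1 L2 \<alpha> C1 C2]) blast+
qed

lemma direct_decomposition_UNIV_0: "direct_decomposition UNIV {0}"
  "direct_decomposition {0} UNIV"
  unfolding direct_decomposition_def by auto

lemma direct_decomposition_obtain:
  assumes "direct_decomposition L1 L2"
  obtains u v where "u \<in> L1" "v \<in> L2" "x = u + v"
  using assms unfolding direct_decomposition_def by blast

text \<open>Follows from e^t > t and the Archimedean property. All refutations of a dichotomy below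
  end here, by contradicting \<alpha> > 0.\<close>

lemma exp_bounded_imp_nonpos:
  fixes \<alpha> :: real
  assumes "C > 0" "\<And>n::nat. C * exp (\<alpha> * real n) \<le> b"
  shows "\<alpha> \<le> 0"
proof (rule ccontr)
  assume "\<not> \<alpha> \<le> 0"
  then have "\<alpha> > 0" by simp
  then obtain n :: nat where n: "b / (C * \<alpha>) < real n"
    using reals_Archimedean2 by blast
  then have "b < C * (\<alpha> * real n)"
    using \<open>C > 0\<close> \<open>\<alpha> > 0\<close> by (simp add: field_simps)
  also have "\<dots> \<le> C * exp (\<alpha> * real n)"
    using \<open>C > 0\<close> exp_gt_self[of "\<alpha> * real n"] by (intro mult_left_mono) auto
  finally show False
    using assms(2)[of n] by simp
qed

section \<open>Constant scalar systems\<close>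

lemma mat_mult_vec: "(mat c :: real^'d^'d) *v x = c *\<^sub>R x"
  by (simp add: matrix_vector_mult_def mat_def vec_eq_iff if_distrib if_distribR cong: if_cong)

lemma scalar_Lya:
  assumes "c > 0"
  shows "(\<lambda>_. mat c) \<in> (Lya :: ('d::finite matseq) set)"
proof (rule LyaI)
  show "\<bar>(mat c :: real^'d^'d) $ k $ l\<bar> \<le> max c (1/c)" for k l
    using assms by (auto simp: mat_def le_max_iff_disj)
  show "\<bar>(mat (1/c) :: real^'d^'d) $ k $ l\<bar> \<le> max c (1/c)" for k l
    using assms by (auto simp: mat_def le_max_iff_disj)
  show "(mat c :: real^'d^'d) ** mat (1/c) = mat 1" "(mat (1/c) :: real^'d^'d) ** mat c = mat 1"
    using assms by (simp_all add: matrix_eq matrix_vector_mul_assoc[symmetric] mat_mult_vec)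
qed

lemma scalar_solution: "solution (\<lambda>_. mat c :: real^'d::finite^'d) x n = c ^ n *\<^sub>R x"
  by (induction n) (simp_all add: mat_mult_vec)

lemma scalar_ED:
  assumes "c > 1"
  shows "(\<lambda>_. mat c) \<in> (ED :: ('d::finite matseq) set)"
proof -
  have "inverse 1 * exp (ln c * real (n - m)) * (c ^ m * norm x) \<le> c ^ n * norm x"
    if "m \<le> n" for m n and x :: "real^'d"
  proof -
    have "exp (ln c * real (n - m)) = c ^ (n - m)"
      using assms by (simp only: exp_of_nat2_mult exp_ln)
    then show ?thesis
      using that by (simp add: mult.assoc[symmetric] power_add[symmetric])
  qed
  then show ?thesis
    unfolding ED_def using assms
    by (intro CollectI conjI exI[of _ "{0}"] exI[of _ UNIV] exI[of _ "ln c"] exI[of _ 1])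
      (simp_all add: scalar_Lya direct_decomposition_UNIV_0 scalar_solution)
qed

lemma identity_in_closure_ED:
  "(\<lambda>_. mat 1) \<in> Lya_topology closure_of (ED :: ('d::finite matseq) set)"
proof -
  interpret Metric_space "Lya :: ('d matseq) set" Lya_dist
    by (rule Metric_space_Lya)
  define D where "D = real CARD('d) * real CARD('d)"
  have D: "D > 0" by (simp add: D_def)
  have "\<exists>B\<in>ED. B \<in> mball (\<lambda>_. mat 1) e" if "e > 0" for e
  proof
    \<comment> \<open>\<open>D\<close> converts entrywise bounds into operator norm bounds, and this
      \<open>c\<close> makes \<open>D * (c - 1)\<close> equal to e/2.\<close>
    define c where "c = 1 + e / (2 * D)"
    have c: "c > 1" using that D by (simp add: c_def)
    show "(\<lambda>_. mat c) \<in> (ED :: ('d matseq) set)"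
      using c by (rule scalar_ED)
    have "Lya_dist (\<lambda>_. mat 1 :: real^'d^'d) (\<lambda>_. mat c) \<le> D * (c - 1)"
      unfolding D_def using c by (intro Lya_dist_le_entries scalar_Lya) (auto simp: mat_def)
    also have "\<dots> < e"
      using D that by (simp add: c_def)
    finally show "(\<lambda>_. mat c) \<in> mball (\<lambda>_. mat 1 :: real^'d^'d) e"
      using c by (simp add: scalar_Lya)
  qed
  then show ?thesis
    unfolding Lya_topology_def metric_closure_of by (simp add: scalar_Lya)
qed

lemma identity_notin_BD: "(\<lambda>_. mat 1) \<notin> (BD :: ('d::finite matseq) set)"
proof
  assume "(\<lambda>_. mat 1) \<in> (BD :: ('d matseq) set)"
  then obtain L1 L2 :: "(real^'d) set" and \<alpha> C1 C2 where dd: "direct_decomposition L1 L2"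
    and pos: "\<alpha> > 0" "\<And>x. C1 x > 0" "\<And>x. C2 x > 0"
    and L1: "\<And>x m n. x \<in> L1 \<Longrightarrow> n \<ge> m \<Longrightarrow> norm (solution (\<lambda>_. mat 1) x n)
      \<le> C1 x * exp (- \<alpha> * real (n - m)) * norm (solution (\<lambda>_. mat 1) x m)"
    and L2: "\<And>x m n. x \<in> L2 \<Longrightarrow> n \<ge> m \<Longrightarrow> norm (solution (\<lambda>_. mat 1) x n)
      \<ge> C2 x * exp (\<alpha> * real (n - m)) * norm (solution (\<lambda>_. mat 1) x m)"
    by (rule BD_E) (rule that)
  \<comment> \<open>Solutions are constant in time, so with m = 0 either estimate bounds
    exp(\<alpha> n) uniformly in n unless x = 0. Both subspaces are then trivial and cannot
    span.\<close>
  have "x = 0" if "x \<in> L1" for x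
  proof (rule ccontr)
    assume x: "x \<noteq> 0"
    have "1 * exp (\<alpha> * real n) \<le> C1 x" for n
      using L1[OF that, of 0 n] x by (simp add: scalar_solution exp_minus field_simps)
    from exp_bounded_imp_nonpos[OF _ this] show False
      using pos(1) by simp
  qed
  moreover have "x = 0" if "x \<in> L2" for x
  proof (rule ccontr)
    assume x: "x \<noteq> 0"
    have "C2 x * exp (\<alpha> * real n) \<le> 1" for n
      using L2[OF that, of 0 n] x by (simp add: scalar_solution)
    from exp_bounded_imp_nonpos[OF pos(3) this] show False
      using pos(1) by simp
  qed
  moreover obtain u v where "u \<in> L1" "v \<in> L2" "(1 :: real^'d) = u + v"
    using dd by (rule direct_decomposition_obtain)
  ultimately have "(1 :: real^'d) = 0" by (metis add.right_neutral)
  then show False by simp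
qed

section \<open>The amplitude with plateaus\<close>

fun block_step :: "nat \<times> nat \<Rightarrow> nat \<times> nat" where
  "block_step (k, j) = (if Suc j < 5 * k then (k, Suc j) else (Suc k, 0))"

definition block_pos :: "nat \<Rightarrow> nat \<times> nat" where
  "block_pos n = (block_step ^^ n) (1, 0)"

definition level :: "nat \<Rightarrow> nat" where
  "level n = fst (block_pos n)"

text \<open>On block \<open>k\<close> the depth runs from 0 up to \<open>3k\<close> with slope 1, down to \<open>k\<close> with slope
  \<open>-2\<close>, and back to 0 with slope \<open>-1\<close>.\<close>

definition block_depth :: "nat \<times> nat \<Rightarrow> nat" where
  "block_depth = (\<lambda>(k, j). min j (max (9 * k - 2 * j) (5 * k - j)))"

definition depth :: "nat \<Rightarrow> nat" where
  "depth n = block_depth (block_pos n)"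

lemma block_pos_0: "block_pos 0 = (1, 0)"
  by (simp add: block_pos_def)

lemma block_pos_Suc: "block_pos (Suc n) = block_step (block_pos n)"
  by (simp add: block_pos_def)

lemma depth_0: "depth 0 = 0"
  by (simp add: depth_def block_depth_def block_pos_0)

lemma block_pos_bounds: "fst (block_pos n) \<ge> 1 \<and> snd (block_pos n) < 5 * fst (block_pos n)"
proof (induction n)
  case 0
  show ?case by (simp add: block_pos_0)
next
  case (Suc n)
  then show ?case
    by (cases "block_pos n") (auto simp: block_pos_Suc)
qed

text \<open>All four facts come from one case analysis of the position inside a block. A drop by 2
  occurs only on the fast descent, which ends at depth k on block k; hence the third clause. A block
  is left from depth 1; hence the fourth.\<close>

lemma depth_step:
  shows depth_Suc_le: "depth (Suc n) \<le> Suc (depth n)"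
    and depth_le: "depth n \<le> depth (Suc n) + 2"
    and depth_fast: "depth n \<le> Suc (depth (Suc n)) \<or> level (Suc n) \<le> depth (Suc n)"
    and level_step: "level (Suc n) = level n \<or> level (Suc n) = Suc (level n) \<and> depth n = 1"
proof -
  obtain k j where kj: "block_pos n = (k, j)" by fastforce
  with block_pos_bounds[of n] have b: "k \<ge> 1" "j < 5 * k" by auto
  show "depth (Suc n) \<le> Suc (depth n)" "depth n \<le> depth (Suc n) + 2"
    "depth n \<le> Suc (depth (Suc n)) \<or> level (Suc n) \<le> depth (Suc n)"
    "level (Suc n) = level n \<or> level (Suc n) = Suc (level n) \<and> depth n = 1"
    using b by (auto simp: depth_def block_depth_def level_def kj block_pos_Suc min_def max_def)
qed

lemma level_mono: "m \<le> n \<Longrightarrow> level m \<le> level n"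
  by (rule lift_Suc_mono_le[of level]) (metis level_step le_SucI order_refl)

text \<open>Ensures that block k starts no earlier than time k - 1, so that plateaus can be found
  arbitrarily late.\<close>

lemma level_le: "level n \<le> Suc n"
proof (induction n)
  case 0
  show ?case by (simp add: level_def block_pos_0)
next
  case (Suc n)
  then show ?case using level_step[of n] by auto
qed

lemma block_pos_within: "block_pos n = (k, 0) \<Longrightarrow> j < 5 * k \<Longrightarrow> block_pos (n + j) = (k, j)"
  by (induction j) (simp_all add: block_pos_Suc)

lemma block_start_exists: "\<exists>n. block_pos n = (Suc k, 0)"
proof (induction k)
  case 0
  show ?case using block_pos_0 by auto
next
  case (Suc k)
  then obtain n where "block_pos n = (Suc k, 0)" by blast
  \<comment> \<open>Block k + 1 has length 5k + 5, so offset 5k + 4 is its last position.\<close>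
  from block_pos_within[OF this, of "5 * k + 4"]
  have "block_pos (Suc (n + (5 * k + 4))) = (Suc (Suc k), 0)"
    unfolding block_pos_Suc by simp
  then show ?case by blast
qed

section \<open>Amplitude and tilt\<close>

definition amp :: "nat \<Rightarrow> real" where
  "amp n = (1/4) ^ n / 2 ^ depth n"

definition tilt :: "nat \<Rightarrow> real" where
  "tilt n = 1 / 2 ^ level n"

lemma amp_pos: "amp n > 0"
  by (simp add: amp_def)

lemma amp_0: "amp 0 = 1"
  by (simp add: amp_def depth_0)

lemma amp_le: "amp n \<le> (1/4) ^ n"
  by (simp add: amp_def field_simps)

text \<open>The ratio is 1/4 times 2 to the drop in depth: 1/8 while the depth rises, 1 on the
  descent of slope -2, and 1/2 on the descent of slope -1.\<close>

lemma amp_ratio: "1/8 \<le> amp (Suc n) / amp n" "amp (Suc n) / amp n \<le> 1"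
proof -
  have "(2::real) ^ depth (Suc n) \<le> 2 ^ Suc (depth n)"
    using depth_Suc_le by (intro power_increasing) auto
  then show "1/8 \<le> amp (Suc n) / amp n"
    by (simp add: amp_def field_simps)
  have "(2::real) ^ depth n \<le> 2 ^ (depth (Suc n) + 2)"
    using depth_le by (intro power_increasing) auto
  then show "amp (Suc n) / amp n \<le> 1"
    by (simp add: amp_def field_simps)
qed

lemma amp_plateau: "\<exists>m\<ge>N. amp (m + T) = amp m"
proof -
  define k where "k = Suc (N + T)"
  obtain n where n: "block_pos n = (k, 0)"
    using block_start_exists unfolding k_def by blast
  then have "N \<le> n"
    using level_le[of n] by (simp add: level_def k_def)
  \<comment> \<open>The fast descent starts at offset 3k and lasts k steps, more than T. The depth
    3k is split so that \<open>2^(2*T)\<close> visibly cancels the decay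
    \<open>4^-T\<close>.\<close>
  have d1: "depth (n + 3 * k) = (3 * k - 2 * T) + 2 * T"
    using block_pos_within[OF n, of "3 * k"]
    by (simp add: depth_def block_depth_def k_def)
  have d2: "depth (n + 3 * k + T) = 3 * k - 2 * T"
    using block_pos_within[OF n, of "3 * k + T"]
    by (simp add: depth_def block_depth_def k_def add.assoc)
  have "amp (n + 3 * k + T) = amp (n + 3 * k)"
    unfolding amp_def d1 d2 by (simp add: power_add power_mult power_divide)
  with \<open>N \<le> n\<close> show ?thesis
    by (intro exI[of _ "n + 3 * k"]) simp
qed

lemma tilt_pos: "tilt n > 0"
  by (simp add: tilt_def)

lemma tilt_le_1: "tilt n \<le> 1"
  by (simp add: tilt_def)

lemma tilt_antimono: "m \<le> n \<Longrightarrow> tilt n \<le> tilt m"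
  using level_mono by (simp add: tilt_def field_simps power_increasing)

lemma tilt_tendsto_0: "tilt \<longlonglongrightarrow> 0"
proof (rule LIMSEQ_I)
  fix e :: real
  assume "e > 0"
  then obtain k where k: "(1/2) ^ k < e"
    using real_arch_pow_inv[of e "1/2"] by auto
  obtain N where N: "block_pos N = (Suc k, 0)"
    using block_start_exists by blast
  have "norm (tilt n - 0) < e" if "n \<ge> N" for n
  proof -
    have "tilt n \<le> tilt N" using that by (rule tilt_antimono)
    also have "tilt N \<le> (1/2) ^ k"
      by (simp add: tilt_def level_def N power_one_over field_simps)
    finally show ?thesis using k tilt_pos[of n] by simp
  qed
  then show "\<exists>N. \<forall>n\<ge>N. norm (tilt n - 0) < e" by blast
qed

text \<open>The tilt changes only on leaving a block. There the depth is 1, so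
  \<open>(1/4)^n / amp n\<close> is 2 and the coupling equals \<open>tilt n / 4\<close>; elsewhere
  it is 0.\<close>

lemma coupling_bounds:
  "0 \<le> (tilt n - tilt (Suc n)) * (1/4) ^ Suc n / amp n"
  "(tilt n - tilt (Suc n)) * (1/4) ^ Suc n / amp n \<le> tilt n"
proof -
  show "0 \<le> (tilt n - tilt (Suc n)) * (1/4) ^ Suc n / amp n"
    using tilt_antimono[of n "Suc n"] amp_pos[of n] by simp
  show "(tilt n - tilt (Suc n)) * (1/4) ^ Suc n / amp n \<le> tilt n"
    using level_step[of n]
    by (auto simp: tilt_def amp_def field_simps)
qed

lemma max_amp_tilt_halves:
  "max (amp (Suc n)) (tilt (Suc n) * (1/4) ^ Suc n) \<le> max (amp n) (tilt n * (1/4) ^ n) / 2"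
proof -
  have 1: "tilt (Suc n) * (1/4) ^ Suc n \<le> (tilt n * (1/4) ^ n) / 2"
  proof -
    have "tilt (Suc n) * (1/4) ^ Suc n \<le> tilt n * (1/4) ^ Suc n"
      by (intro mult_right_mono tilt_antimono) auto
    also have "\<dots> \<le> (tilt n * (1/4) ^ n) / 2"
      using tilt_pos[of n] by (simp add: field_simps)
    finally show ?thesis .
  qed
  \<comment> \<open>A depth drop of at most 1 leaves a ratio of at most 1/2. After a drop by 2 the
    depth is still at least the level, so the amplitude lies below the tilt term.\<close>
  have 2: "amp (Suc n) \<le> amp n / 2 \<or> amp (Suc n) \<le> tilt (Suc n) * (1/4) ^ Suc n"
    using depth_fast[of n]
  proof
    assume "depth n \<le> Suc (depth (Suc n))"
    then have "(2::real) ^ depth n \<le> 2 ^ Suc (depth (Suc n))"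
      by (intro power_increasing) auto
    then show ?thesis by (simp add: amp_def field_simps)
  next
    assume "level (Suc n) \<le> depth (Suc n)"
    then have "(2::real) ^ level (Suc n) \<le> 2 ^ depth (Suc n)"
      by (intro power_increasing) auto
    then show ?thesis by (simp add: amp_def tilt_def field_simps)
  qed
  show ?thesis using 1 2 by linarith
qed

section \<open>The triangular systems\<close>

definition shear :: "'d::finite \<Rightarrow> 'd \<Rightarrow> real \<Rightarrow> real \<Rightarrow> real \<Rightarrow> real^'d^'d" where
  "shear i j a b e = (\<chi> k l. if k = l then (if k = i then a else b)
     else if k = j \<and> l = i then e else 0)"

lemma shear_mult_vec:
  assumes "i \<noteq> j"
  shows "(shear i j a b e *v x) $ k =
    (if k = i then a * x $ i else if k = j then b * x $ j + e * x $ i else b * x $ k)"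
proof -
  have "(shear i j a b e *v x) $ k =
    (\<Sum>l\<in>UNIV. (if l = k then (if k = i then a else b) * x $ k else 0)
       + (if l = i then (if k = j then e else 0) * x $ i else 0))"
    unfolding shear_def matrix_vector_mult_def using assms
    by (auto intro!: sum.cong)
  also have "\<dots> = (if k = i then a else b) * x $ k + (if k = j then e else 0) * x $ i"
    by (simp add: sum.distrib)
  finally show ?thesis using assms by auto
qed

lemma shear_inverse:
  assumes "i \<noteq> j" "a \<noteq> 0" "b \<noteq> 0"
  shows "shear i j a b e ** shear i j (1/a) (1/b) (- e / (a * b)) = mat 1"
    "shear i j (1/a) (1/b) (- e / (a * b)) ** shear i j a b e = mat 1"
  using assms
  by (simp_all add: matrix_eq vec_eq_iff matrix_vector_mul_assoc[symmetric] shear_mult_vec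
      field_simps)

text \<open>The coupling is obtained by solving the recursion for the prescribed coordinate
  \<open>x_j(n) = 4^-n (x_j(0) + (\<sigma> 0 - \<sigma> n) x_i(0))\<close>.\<close>

definition plateau_system :: "'d::finite \<Rightarrow> 'd \<Rightarrow> (nat \<Rightarrow> real) \<Rightarrow> 'd matseq" where
  "plateau_system i j \<sigma> n =
     shear i j (amp (Suc n) / amp n) (1/4) ((\<sigma> n - \<sigma> (Suc n)) * (1/4) ^ Suc n / amp n)"

lemma plateau_system_solution:
  assumes "i \<noteq> j"
  shows "solution (plateau_system i j \<sigma>) x n $ k =
    (if k = i then amp n * x $ i
     else if k = j then (1/4) ^ n * (x $ j + (\<sigma> 0 - \<sigma> n) * x $ i)
     else (1/4) ^ n * x $ k)"
proof (induction n arbitrary: k)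
  case 0
  show ?case by (simp add: amp_0)
next
  case (Suc n)
  define v where "v = solution (plateau_system i j \<sigma>) x n"
  have v: "v $ k = (if k = i then amp n * x $ i
     else if k = j then (1/4) ^ n * (x $ j + (\<sigma> 0 - \<sigma> n) * x $ i)
     else (1/4) ^ n * x $ k)" for k
    unfolding v_def by (rule Suc.IH)
  have "solution (plateau_system i j \<sigma>) x (Suc n) = shear i j (amp (Suc n) / amp n) (1/4)
     ((\<sigma> n - \<sigma> (Suc n)) * (1/4) ^ Suc n / amp n) *v v"
    unfolding v_def solution.simps(2) by (subst plateau_system_def) simp
  moreover have "amp n \<noteq> 0" using amp_pos[of n] by simp
  ultimately show ?case
    using assms by (simp add: shear_mult_vec v del: solution.simps) (simp add: field_simps)
qed

lemma plateau_system_Lya: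
  fixes i j :: "'d::finite"
  assumes "i \<noteq> j" and e: "\<And>n. \<bar>(\<sigma> n - \<sigma> (Suc n)) * (1/4) ^ Suc n / amp n\<bar> \<le> 1"
  shows "plateau_system i j \<sigma> \<in> Lya"
proof -
  define a where "a n = amp (Suc n) / amp n" for n
  define c where "c n = (\<sigma> n - \<sigma> (Suc n)) * (1/4) ^ Suc n / amp n" for n
  have a: "1/8 \<le> a n" "a n \<le> 1" for n
    using amp_ratio[of n] by (simp_all add: a_def)
  have c: "\<bar>c n\<bar> \<le> 1" for n
    using e by (simp add: c_def)
  have S: "plateau_system i j \<sigma> = (\<lambda>n. shear i j (a n) (1/4) (c n))"
    by (simp add: fun_eq_iff plateau_system_def a_def c_def)
  define B where "B n = shear i j (1 / a n) (1 / (1/4)) (- c n / (a n * (1/4)))" for n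
  have a0: "a n \<noteq> 0" for n using a(1)[of n] by simp
  show ?thesis
  proof (rule LyaI)
    show "plateau_system i j \<sigma> n ** B n = mat 1" "B n ** plateau_system i j \<sigma> n = mat 1" for n
      unfolding S B_def by (rule shear_inverse; use assms(1) a0 in simp)+
    show "\<bar>plateau_system i j \<sigma> n $ k $ l\<bar> \<le> 32" for n k l
      using a[of n] c[of n] by (auto simp: S shear_def)
    \<comment> \<open>The largest entry of the inverse is its coupling, of modulus 4 |c| / a, at
      most 4 * 8 = 32 because a is at least 1/8.\<close>
    have "\<bar>c n\<bar> \<le> 8 * a n" for n
      using a(1)[of n] c[of n] by linarith
    then have "\<bar>- c n / (a n * (1/4))\<bar> \<le> 32" for n
      using a(1)[of n] by (simp add: abs_mult field_simps)
    moreover have "\<bar>1 / a n\<bar> \<le> 32" for n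
      using a(1)[of n] by (simp add: field_simps)
    ultimately show "\<bar>B n $ k $ l\<bar> \<le> 32" for n k l
      by (simp add: B_def shear_def)
  qed
qed

lemma plateau_system_tilt_Lya:
  assumes "i \<noteq> j"
  shows "plateau_system i j tilt \<in> Lya"
  using coupling_bounds tilt_le_1
  by (intro plateau_system_Lya assms) (metis abs_of_nonneg order_trans)

text \<open>The coupling at time n uses the tilt at n and n + 1. If n < N then also n + 1 <= N, so
  nothing changes; from n = N on both values are \<open>tilt N\<close>.\<close>

lemma frozen_coupling:
  "(tilt (min n N) - tilt (min (Suc n) N)) * (1/4) ^ Suc n / amp n =
     (if n < N then (tilt n - tilt (Suc n)) * (1/4) ^ Suc n / amp n else 0)"
  by (auto simp: min_def)

lemma plateau_system_frozen_Lya: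
  assumes "i \<noteq> j"
  shows "plateau_system i j (\<lambda>n. tilt (min n N)) \<in> Lya"
proof (rule plateau_system_Lya[OF assms])
  show "\<bar>(tilt (min n N) - tilt (min (Suc n) N)) * (1/4) ^ Suc n / amp n\<bar> \<le> 1" for n
    unfolding frozen_coupling using coupling_bounds[of n] tilt_le_1[of n] by auto
qed

lemma frozen_dist_le:
  fixes i j :: "'d::finite"
  assumes "i \<noteq> j"
  shows "Lya_dist (plateau_system i j tilt) (plateau_system i j (\<lambda>n. tilt (min n N)))
    \<le> real CARD('d) * real CARD('d) * tilt N"
proof (intro Lya_dist_le_entries plateau_system_tilt_Lya plateau_system_frozen_Lya assms)
  fix n and k l :: 'd
  have "(tilt n - tilt (Suc n)) * (1/4) ^ Suc n / amp n \<le> tilt N" if "N \<le> n"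
    using coupling_bounds(2)[of n] tilt_antimono[OF that] by linarith
  then show "\<bar>plateau_system i j tilt n $ k $ l
      - plateau_system i j (\<lambda>n. tilt (min n N)) n $ k $ l\<bar> \<le> tilt N"
    unfolding plateau_system_def frozen_coupling shear_def
    using coupling_bounds(1)[of n] tilt_pos[of N] by auto
qed

section \<open>Bohl dichotomy of the coupled system\<close>

lemma eventually_bounded_below_imp_bounded_below:
  fixes f :: "nat \<Rightarrow> real"
  assumes "\<And>n. f n > 0" "\<And>n. n \<ge> N \<Longrightarrow> f n \<ge> c" "c > 0"
  shows "\<exists>lo>0. \<forall>n. lo \<le> f n"
proof (intro exI[of _ "Min (insert c (f ` {..<N}))"] conjI allI)
  show "Min (insert c (f ` {..<N})) > 0"
    using assms by (subst Min_gr_iff) auto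
  show "Min (insert c (f ` {..<N})) \<le> f n" for n
  proof (cases "n < N")
    case True
    then show ?thesis by (intro Min_le) auto
  next
    case False
    then have "Min (insert c (f ` {..<N})) \<le> c" "c \<le> f n"
      using assms by auto
    then show ?thesis by linarith
  qed
qed

text \<open>Passing from f to W costs \<open>hi\<close>, halving W gives \<open>2^-(n-m)\<close>,
  and returning to f costs 1/\<open>lo\<close>. The rate ln 2 is thus common to all solutions, and
  only \<open>hi / lo\<close> depends on the solution.\<close>

lemma halving_comparison:
  fixes f W :: "nat \<Rightarrow> real"
  assumes "lo > 0" "hi > 0" and "\<And>n. lo * W n \<le> f n" "\<And>n. f n \<le> hi * W n"
    and half: "\<And>n. W (Suc n) \<le> W n / 2"
  shows "\<exists>C>0. \<forall>m n. m \<le> n \<longrightarrow> f n \<le> C * exp (- ln 2 * real (n - m)) * f m"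
proof (intro exI[of _ "hi / lo"] conjI allI impI)
  show "hi / lo > 0" using assms by simp
  fix m n :: nat
  assume "m \<le> n"
  have W: "W (m + t) \<le> (1/2) ^ t * W m" for t
  proof (induction t)
    case (Suc t)
    show ?case using half[of "m + t"] Suc by simp
  qed simp
  have e: "exp (- ln 2 * real (n - m)) = (1/2) ^ (n - m)"
    by (simp add: exp_minus exp_of_nat_mult mult.commute[of "ln 2"] power_one_over inverse_eq_divide)
  have "f n \<le> hi * ((1/2) ^ (n - m) * W m)"
    using assms(4)[of n] W[of "n - m"] \<open>m \<le> n\<close> \<open>hi > 0\<close>
    by (simp add: order_trans)
  also have "\<dots> \<le> hi * ((1/2) ^ (n - m) * (f m / lo))"
    using assms(1,2,3) by (intro mult_left_mono) (auto simp: field_simps)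
  finally show "f n \<le> hi / lo * exp (- ln 2 * real (n - m)) * f m"
    unfolding e by (simp add: field_simps)
qed

lemma plateau_system_solution_decay:
  fixes i j :: "'d::finite"
  assumes "i \<noteq> j"
  shows "\<exists>C>0. \<forall>m n. m \<le> n \<longrightarrow> norm (solution (plateau_system i j tilt) x n)
    \<le> C * exp (- ln 2 * real (n - m)) * norm (solution (plateau_system i j tilt) x m)"
proof -
  define X where "X = solution (plateau_system i j tilt) x"
  \<comment> \<open>This is the limit of \<open>4^n * X n $ j\<close>, since the tilt tends to
    0.\<close>
  define y where "y = x $ j + tilt 0 * x $ i"
  have Xi: "X n $ i = amp n * x $ i"
    and Xj: "X n $ j = (1/4) ^ n * (y - tilt n * x $ i)"
    and Xk: "k \<noteq> i \<Longrightarrow> k \<noteq> j \<Longrightarrow> X n $ k = (1/4) ^ n * x $ k" for n k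
    using assms by (simp_all add: X_def y_def plateau_system_solution algebra_simps)
  have comp: "\<bar>X n $ k\<bar> \<le> norm (X n)" for n k
    by (rule component_le_norm_cart)
  have "\<exists>C>0. \<forall>m n. m \<le> n \<longrightarrow> norm (X n) \<le> C * exp (- ln 2 * real (n - m)) * norm (X m)"
  \<comment> \<open>In this exceptional case only the amplitude and the tilt term remain, both
    multiplied by \<open>x $ i\<close>. Otherwise some coordinate has exact order
    \<open>4^-n\<close> for large n.\<close>
  proof (cases "y = 0 \<and> (\<forall>k. k \<noteq> i \<longrightarrow> k \<noteq> j \<longrightarrow> x $ k = 0)")
    case True
    define W where "W n = max (amp n) (tilt n * (1/4) ^ n)" for n
    show ?thesis
    proof (cases "x $ i = 0")
      case True
      then have "X n = 0" for n
        using \<open>y = 0 \<and> _\<close> Xi Xj Xk by (metis (no_types) mult_zero_right diff_zero vec_eq_iff zero_index)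
      then show ?thesis by (intro exI[of _ 1]) simp
    next
      case False
      show ?thesis
      proof (rule halving_comparison)
        show "W (Suc n) \<le> W n / 2" for n
          unfolding W_def by (rule max_amp_tilt_halves)
        show "\<bar>x $ i\<bar> > 0" "real CARD('d) * \<bar>x $ i\<bar> > 0" using False by simp_all
        have Xi': "\<bar>X n $ i\<bar> = \<bar>x $ i\<bar> * amp n" for n
          using amp_pos[of n] by (simp add: Xi abs_mult)
        have Xj': "\<bar>X n $ j\<bar> = \<bar>x $ i\<bar> * (tilt n * (1/4) ^ n)" for n
          using tilt_pos[of n] \<open>y = 0 \<and> _\<close> by (simp add: Xj abs_mult)
        show "\<bar>x $ i\<bar> * W n \<le> norm (X n)" for n
          using comp[of n i] comp[of n j] unfolding Xi' Xj' W_def by (auto simp: max_def)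
        have "\<bar>X n $ k\<bar> \<le> \<bar>x $ i\<bar> * W n" for n k
        proof -
          consider "k = i" | "k = j" | "k \<noteq> i" "k \<noteq> j" by blast
          then show ?thesis
          proof cases
            case 3
            then have "X n $ k = 0" using \<open>y = 0 \<and> _\<close> Xk by simp
            then show ?thesis using amp_pos[of n] by (simp add: W_def le_max_iff_disj)
          qed (simp_all add: Xi' Xj' W_def mult_left_mono)
        qed
        then have "(\<Sum>k\<in>UNIV. \<bar>X n $ k\<bar>) \<le> real CARD('d) * (\<bar>x $ i\<bar> * W n)" for n
          by (intro sum_bounded_above) auto
        then show "norm (X n) \<le> real CARD('d) * \<bar>x $ i\<bar> * W n" for n
          using norm_le_l1_cart[of "X n"] by (simp add: mult.assoc order_trans)
      qed
    qed
  next
    case False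
    define W where "W n = (1/4 :: real) ^ n" for n
    have W: "W n > 0" for n by (simp add: W_def)
    have "\<exists>lo>0. \<forall>n. lo \<le> norm (X n) / W n"
    proof (cases "y = 0")
      case True
      then obtain k where k: "k \<noteq> i" "k \<noteq> j" "x $ k \<noteq> 0" using False by blast
      have "\<bar>x $ k\<bar> \<le> norm (X n) / W n" for n
        using comp[of n k] by (simp add: Xk k W_def abs_mult field_simps)
      then show ?thesis using k by (intro exI[of _ "\<bar>x $ k\<bar>"]) simp
    next
      case False
      have "(\<lambda>n. \<bar>y - tilt n * x $ i\<bar>) \<longlonglongrightarrow> \<bar>y - 0 * x $ i\<bar>"
        by (intro tendsto_intros tilt_tendsto_0)
      then have "\<forall>\<^sub>F n in sequentially. \<bar>y\<bar> / 2 < \<bar>y - tilt n * x $ i\<bar>"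
        using False by (intro order_tendstoD) auto
      then obtain N where N: "\<And>n. n \<ge> N \<Longrightarrow> \<bar>y\<bar> / 2 < \<bar>y - tilt n * x $ i\<bar>"
        by (auto simp: eventually_sequentially)
      show ?thesis
      \<comment> \<open>The limit argument covers only n >= N. The finitely many earlier quotients
        are positive because the solution never vanishes. As N depends on x, so does
        \<open>lo\<close>.\<close>
      proof (rule eventually_bounded_below_imp_bounded_below)
        have "X n \<noteq> 0" for n
        proof
          assume "X n = 0"
          then have "X n $ i = 0" "X n $ j = 0" by simp_all
          then show False using amp_pos[of n] False by (simp add: Xi Xj)
        qed
        then show "norm (X n) / W n > 0" for n using W by simp
        show "\<bar>y\<bar> / 2 > 0" using False by simp
        show "\<bar>y\<bar> / 2 \<le> norm (X n) / W n" if "n \<ge> N" for n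
        proof -
          have "\<bar>y - tilt n * x $ i\<bar> \<le> norm (X n) / W n"
            using comp[of n j] by (simp add: Xj W_def abs_mult field_simps)
          then show ?thesis using N[OF that] by linarith
        qed
      qed
    qed
    then obtain lo where lo: "lo > 0" "\<And>n. lo \<le> norm (X n) / W n" by blast
    \<comment> \<open>The terms |y| and \<open>norm x\<close> dominate the two parts of coordinate
      j, and \<open>norm x\<close> the other coordinates; the 1 makes positivity immediate.\<close>
    define H where "H = 1 + \<bar>y\<bar> + norm x"
    have "\<bar>X n $ k\<bar> \<le> H * W n" for n k
    proof -
      consider "k = i" | "k = j" | "k \<noteq> i" "k \<noteq> j" by blast
      then show ?thesis
      proof cases
        case 1
        have "amp n * \<bar>x $ i\<bar> \<le> W n * H"
          using amp_le[of n] amp_pos[of n] component_le_norm_cart[of x i]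
          by (intro mult_mono) (auto simp: W_def H_def)
        then show ?thesis using 1 amp_pos[of n] by (simp add: Xi abs_mult mult.commute)
      next
        case 2
        have "tilt n * \<bar>x $ i\<bar> \<le> 1 * norm x"
          using tilt_le_1 tilt_pos[of n] component_le_norm_cart[of x i] by (intro mult_mono) auto
        then have "\<bar>tilt n * x $ i\<bar> \<le> norm x"
          using tilt_pos[of n] by (simp add: abs_mult)
        then have "\<bar>y - tilt n * x $ i\<bar> \<le> H" unfolding H_def by linarith
        then show ?thesis using 2 by (simp add: Xj W_def abs_mult)
      next
        case 3
        have "\<bar>x $ k\<bar> \<le> H" using component_le_norm_cart[of x k] unfolding H_def by linarith
        then show ?thesis using 3 by (simp add: Xk W_def abs_mult)
      qed
    qed
    then have "(\<Sum>k\<in>UNIV. \<bar>X n $ k\<bar>) \<le> real CARD('d) * (H * W n)" for n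
      by (intro sum_bounded_above) auto
    then have hi: "norm (X n) \<le> real CARD('d) * H * W n" for n
      using norm_le_l1_cart[of "X n"] by (simp add: mult.assoc order_trans)
    show ?thesis
    proof (rule halving_comparison)
      show "lo > 0" by (rule lo)
      show "real CARD('d) * H > 0" by (simp add: H_def add_pos_nonneg)
      show "lo * W n \<le> norm (X n)" for n
        using lo(2)[of n] W[of n] by (simp add: field_simps)
      show "norm (X n) \<le> real CARD('d) * H * W n" for n by (rule hi)
      show "W (Suc n) \<le> W n / 2" for n by (simp add: W_def)
    qed
  qed
  then show ?thesis by (simp add: X_def)
qed

lemma plateau_system_BD:
  fixes i j :: "'d::finite"
  assumes "i \<noteq> j"
  shows "plateau_system i j tilt \<in> BD"
proof -
  obtain C where C: "\<forall>x. C x > 0 \<and> (\<forall>m n. m \<le> n \<longrightarrow> norm (solution (plateau_system i j tilt) x n)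
    \<le> C x * exp (- ln 2 * real (n - m)) * norm (solution (plateau_system i j tilt) x m))"
    using plateau_system_solution_decay[OF assms] by metis
  have "solution A 0 n = 0" for A :: "'d matseq" and n
    by (induction n) simp_all
  with C show ?thesis
    unfolding BD_def
    by (intro CollectI conjI exI[of _ UNIV] exI[of _ "{0}"] exI[of _ "ln 2"] exI[of _ C]
        exI[of _ "\<lambda>_. 1"])
      (simp_all add: plateau_system_tilt_Lya[OF assms] direct_decomposition_UNIV_0)
qed

section \<open>Failure of the Bohl dichotomy after freezing\<close>

lemma plateau_system_frozen_notin_BD:
  fixes i j :: "'d::finite"
  assumes "i \<noteq> j"
  shows "plateau_system i j (\<lambda>n. tilt (min n N)) \<notin> BD"
proof
  define A where "A = plateau_system i j (\<lambda>n. tilt (min n N))"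
  assume "plateau_system i j (\<lambda>n. tilt (min n N)) \<in> BD"
  then have "A \<in> BD" by (simp only: A_def)
  then obtain L1 L2 :: "(real^'d) set" and \<alpha> C1 C2 where dd: "direct_decomposition L1 L2"
    and pos: "\<alpha> > 0" "\<And>x. C1 x > 0" "\<And>x. C2 x > 0"
    and L1: "\<And>x m n. x \<in> L1 \<Longrightarrow> n \<ge> m \<Longrightarrow>
      norm (solution A x n) \<le> C1 x * exp (- \<alpha> * real (n - m)) * norm (solution A x m)"
    and L2: "\<And>x m n. x \<in> L2 \<Longrightarrow> n \<ge> m \<Longrightarrow>
      norm (solution A x n) \<ge> C2 x * exp (\<alpha> * real (n - m)) * norm (solution A x m)"
    by (rule BD_E) (rule that)
  have sol: "solution A x n $ k =
    (if k = i then amp n * x $ i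
     else if k = j then (1/4) ^ n * (x $ j + (tilt 0 - tilt (min n N)) * x $ i)
     else (1/4) ^ n * x $ k)" for x n k
    unfolding A_def using plateau_system_solution[OF assms, of "\<lambda>n. tilt (min n N)"] by simp
  \<comment> \<open>All multipliers in the solution formula lie in [0, 1], so every solution is
    bounded and exponential growth forces x = 0.\<close>
  have "x = 0" if x: "x \<in> L2" for x
  proof (rule ccontr)
    assume "x \<noteq> 0"
    have pw: "(1/4::real) ^ n \<le> 1" for n by (simp add: power_le_one)
    have "\<bar>solution A x n $ k\<bar> \<le> 2 * norm x" for n k
    proof -
      have le: "\<bar>x $ l\<bar> \<le> norm x" for l by (rule component_le_norm_cart)
      have contr: "\<bar>c * z\<bar> \<le> b" if "0 \<le> c" "c \<le> 1" "\<bar>z\<bar> \<le> b" for b c z :: real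
        using mult_mono[of c 1 "\<bar>z\<bar>" b] that by (simp add: abs_mult)
      have "\<bar>(tilt 0 - tilt (min n N)) * x $ i\<bar> \<le> norm x"
        using tilt_antimono[of 0 "min n N"] tilt_pos[of "min n N"] tilt_le_1[of 0] le
        by (intro contr) auto
      then have "\<bar>x $ j + (tilt 0 - tilt (min n N)) * x $ i\<bar> \<le> 2 * norm x"
        using le[of j] by linarith
      moreover have "\<bar>x $ l\<bar> \<le> 2 * norm x" for l using le[of l] norm_ge_zero[of x] by linarith
      moreover have "amp n \<le> 1" using amp_le[of n] pw[of n] by linarith
      ultimately show ?thesis
        unfolding sol using amp_pos[of n] pw[of n] by (auto intro!: contr)
    qed
    then have "(\<Sum>k\<in>UNIV. \<bar>solution A x n $ k\<bar>) \<le> real CARD('d) * (2 * norm x)" for n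
      by (intro sum_bounded_above) auto
    then have bd: "norm (solution A x n) \<le> real CARD('d) * (2 * norm x)" for n
      using norm_le_l1_cart order_trans by blast
    have "C2 x * norm x * exp (\<alpha> * real n) \<le> real CARD('d) * (2 * norm x)" for n
      using L2[OF x, of 0 n] bd[of n] by (simp add: mult.commute mult.left_commute)
    from exp_bounded_imp_nonpos[OF _ this] show False
      using pos \<open>x \<noteq> 0\<close> by simp
  qed
  then have L1_UNIV: "x \<in> L1" for x
    using direct_decomposition_obtain[OF dd, of x] by (metis add.right_neutral)
  \<comment> \<open>Coordinate j of y is chosen to cancel \<open>tilt 0 - tilt (min n N)\<close>,
    which is constant for n >= N.\<close>
  define y where "y = axis i 1 - (tilt 0 - tilt N) *\<^sub>R axis j (1::real)"
  have "solution A y n = amp n *\<^sub>R axis i 1" if "n \<ge> N" for n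
    using that assms by (auto simp: vec_eq_iff sol y_def axis_def min_def)
  then have norm_y: "norm (solution A y n) = amp n" if "n \<ge> N" for n
    using that amp_pos[of n] by simp
  \<comment> \<open>Between the ends of a plateau of length T beyond N the norm does not change, so
    the single constant \<open>C1 y\<close> would have to absorb exp(\<alpha> T) for every
    T.\<close>
  have "1 * exp (\<alpha> * real T) \<le> C1 y" for T
  proof -
    obtain m where m: "m \<ge> N" "amp (m + T) = amp m" using amp_plateau by blast
    have "amp m \<le> C1 y * exp (- \<alpha> * real T) * amp m"
      using L1[OF L1_UNIV, of m "m + T" y] m by (simp add: norm_y)
    then have "1 \<le> C1 y * exp (- \<alpha> * real T)"
      using amp_pos[of m] by simp
    then show ?thesis by (simp add: exp_minus field_simps)
  qed
  from exp_bounded_imp_nonpos[OF _ this] show False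
    using pos(1) by simp
qed

section \<open>Topological conclusions\<close>

lemma BD_not_open:
  assumes "CARD('d) > 1"
  shows "\<not> openin Lya_topology (BD :: ('d::finite matseq) set)"
proof
  interpret Metric_space "Lya :: ('d matseq) set" Lya_dist
    by (rule Metric_space_Lya)
  obtain i j :: 'd where ij: "i \<noteq> j"
    using assms by (metis (full_types) One_nat_def card_1_singleton_iff UNIV_eq_I
        less_irrefl singleton_iff)
  assume "openin Lya_topology (BD :: ('d matseq) set)"
  then obtain e where e: "e > 0" "mball (plateau_system i j tilt) e \<subseteq> BD"
    unfolding Lya_topology_def openin_mtopology using plateau_system_BD[OF ij] by blast
  have "(\<lambda>N. real CARD('d) * real CARD('d) * tilt N) \<longlonglongrightarrow> real CARD('d) * real CARD('d) * 0"
    by (intro tendsto_intros tilt_tendsto_0)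
  then have "\<forall>\<^sub>F N in sequentially. real CARD('d) * real CARD('d) * tilt N < e"
    using e(1) by (intro order_tendstoD) auto
  then obtain N where "real CARD('d) * real CARD('d) * tilt N < e"
    by (auto simp: eventually_sequentially)
  then have "plateau_system i j (\<lambda>n. tilt (min n N)) \<in> mball (plateau_system i j tilt) e"
    using frozen_dist_le[OF ij, of N] plateau_system_tilt_Lya[OF ij]
      plateau_system_frozen_Lya[OF ij, of N] by simp
  then show False
    using e(2) plateau_system_frozen_notin_BD[OF ij] by blast
qed

theorem corollary30:
  shows "\<not> closedin Lya_topology (BD :: ('d::finite matseq) set)
       \<and> \<not> (Lya_topology closure_of (ED :: ('d matseq) set) \<subseteq> (BD :: ('d matseq) set))
       \<and> (CARD('d) > 1 \<longrightarrow> \<not> openin Lya_topology (BD :: ('d matseq) set))"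
proof (intro conjI impI)
  show *: "\<not> (Lya_topology closure_of (ED :: ('d matseq) set) \<subseteq> (BD :: ('d matseq) set))"
    using identity_in_closure_ED identity_notin_BD by blast
  \<comment> \<open>If BD were closed, it would contain the closure of its subset ED.\<close>
  show "\<not> closedin Lya_topology (BD :: ('d matseq) set)"
    using * closure_of_minimal[OF ED_subset_BD] by blast
qed (rule BD_not_open)

end
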